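(* Let $n$ and $m$ be natural numbers, and let $p$ be a prime number. Then \[ p^m \;\Big|\; n^{p^m}+\sum_{s=1}^m (p^s-p^{s-1})\,n^{p^{m-s}}. \] *)

theory Defs
  imports "HOL-Number_Theory.Number_Theory"
begin

end

theory Submission
  imports Defs
begin

text \<open>
  Writing \<open>S m\<close> for the sum in question, one has
  \<open>S (m + 1) = n ^ p ^ (m + 1) - n ^ p ^ m + p * S m\<close>, so the claim follows by induction on \<open>m\<close>
  from the congruence of \<open>n ^ p ^ (m + 1)\<close> and \<open>n ^ p ^ m\<close> modulo \<open>p ^ (m + 1)\<close>. The latter is
  Euler's theorem if \<open>p\<close> does not divide \<open>n\<close>; otherwise both powers vanish modulo
  \<open>p ^ (m + 1)\<close> because \<open>m + 1 \<le> p ^ m\<close>.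
\<close>

lemma cong_prime_power_exponent:
  fixes n m p :: nat
  assumes "prime p"
  shows "[n ^ p ^ Suc m = n ^ p ^ m] (mod p ^ Suc m)"
proof (cases "p dvd n")
  case True
  have p: "1 < p"
    using assms by (rule prime_gt_1_nat)
  have "Suc m \<le> p ^ m"
    using p less_exp[of m] power_mono[of 2 p m] by linarith
  moreover have "p ^ m \<le> p ^ Suc m"
    using p by (intro power_increasing) auto
  ultimately have "p ^ Suc m dvd n ^ p ^ m" "p ^ Suc m dvd n ^ p ^ Suc m"
    using True by (meson dvd_power_le le_trans)+
  then show ?thesis
    by (metis cong_0_iff cong_sym cong_trans)
next
  case False
  then have "coprime n (p ^ Suc m)"
    using assms by (metis coprime_commute coprime_power_right_iff prime_imp_coprime)
  then have "[n ^ totient (p ^ Suc m) = 1] (mod p ^ Suc m)"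
    by (rule euler_theorem)
  \<comment> \<open>The factor \<open>n ^ p ^ m\<close> lifts the exponent to
    \<open>p ^ m + totient (p ^ Suc m)\<close>, which is \<open>p ^ Suc m\<close>.\<close>
  then have "[n ^ p ^ m * n ^ totient (p ^ Suc m) = n ^ p ^ m * 1] (mod p ^ Suc m)"
    by (rule cong_scalar_left)
  moreover have "p ^ Suc m = p ^ m + totient (p ^ Suc m)"
    unfolding totient_prime_power_Suc[OF assms]
    using prime_gt_0_nat[OF assms] by (simp flip: mult_Suc_right)
  ultimately show ?thesis
    by (metis power_add mult.right_neutral)
qed

theorem proposition9:
  fixes n m p :: nat
  assumes "prime p"
  shows "p ^ m dvd n ^ (p ^ m) + (\<Sum>s = 1..m. (p ^ s - p ^ (s - 1)) * n ^ (p ^ (m - s)))"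
proof (induction m)
  case 0
  show ?case by simp
next
  case (Suc m)
  define T where "T k = (\<Sum>s = 1..k. (p ^ s - p ^ (s - 1)) * n ^ (p ^ (k - s)))" for k
  \<comment> \<open>Split off \<open>s = 1\<close> and shift the index; \<open>Suc m - Suc s\<close>
    is \<open>m - s\<close>.\<close>
  have "T (Suc m) = (p - 1) * n ^ p ^ m
      + (\<Sum>s = 1..m. (p ^ Suc s - p ^ s) * n ^ (p ^ (m - s)))"
    unfolding T_def
    by (subst sum.atLeast_Suc_atMost) (simp_all add: sum.shift_bounds_cl_Suc_ivl del: sum.cl_ivl_Suc)
  also have "(\<Sum>s = 1..m. (p ^ Suc s - p ^ s) * n ^ (p ^ (m - s))) = p * T m"
    unfolding T_def sum_distrib_left
  proof (rule sum.cong)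
    fix s assume "s \<in> {1..m}"
    \<comment> \<open>Truncated subtraction makes \<open>p * p ^ (s - 1) = p ^ s\<close> depend on
      \<open>s\<close> being positive.\<close>
    then obtain r where "s = Suc r"
      by (cases s) auto
    then show "(p ^ Suc s - p ^ s) * n ^ (p ^ (m - s)) =
        p * ((p ^ s - p ^ (s - 1)) * n ^ (p ^ (m - s)))"
      by (simp add: right_diff_distrib' diff_mult_distrib)
  qed simp
  finally have T_Suc: "T (Suc m) = (p - 1) * n ^ p ^ m + p * T m" .
  \<comment> \<open>The new \<open>n ^ p ^ m\<close> raises the coefficient \<open>p - 1\<close> in
    \<open>T_Suc\<close> to \<open>p\<close>, so a factor \<open>p\<close> comes out.\<close>
  have "[n ^ p ^ Suc m + T (Suc m) = n ^ p ^ m + T (Suc m)] (mod p ^ Suc m)"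
    using cong_prime_power_exponent[OF assms] by (rule cong_add) simp
  also have "n ^ p ^ m + T (Suc m) = (1 + (p - 1)) * n ^ p ^ m + p * T m"
    unfolding T_Suc by (simp only: distrib_right mult_1 add.assoc)
  also have "\<dots> = p * (n ^ p ^ m + T m)"
    using prime_gt_0_nat[OF assms] by (simp add: distrib_left)
  finally show ?case
    using Suc.IH mult_dvd_mono[of p p "p ^ m"] by (simp add: T_def cong_dvd_iff)
qed

end
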